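(* Let $n\ge 1$ and $r\ge 1$ be integers. For each $j=1,\ldots,n$ let $x_{j,0}=-1$, $x_{j,1}=1$, and let $x_{j,k}\in(-1,1)$ for $k=2,\ldots,r$ be real numbers, not necessarily distinct. For $\alpha\in S_r$ put $x_\alpha=(x_{1,\alpha_1},\ldots,x_{n,\alpha_n})\in[-1,1]^n$. Then: (i) for every $\beta\in\{0,1,2\}^n$ and every $\alpha\in S_r$, one has $x_\alpha\in f_\beta$ if and only if $\alpha\in S_{r,\beta}$; (ii) suppose further that, for each $j=1,\ldots,n$, the coordinates $x_{j,2},\ldots,x_{j,r}$ are distinct. Then for every function $u:\mathbb{R}^n\to\mathbb{R}$ there is a unique polynomial $p\in\mathcal{S}_r$ such that $p(x_\alpha)=u(x_\alpha)$ for all $\alpha\in S_r$; and the polynomials $\phi_\alpha\in\mathcal{S}_r$, $\alpha\in S_r$, defined by $\phi_\alpha(x_{\alpha'})=\delta_{\alpha,\alpha'}$ for all $\alpha,\alpha'\in S_r$, form a basis of $\mathcal{S}_r$.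
   Context: $\mathbb{N}_0=\{0,1,2,\ldots\}$. For $\alpha=(\alpha_1,\ldots,\alpha_n)\in\mathbb{N}_0^n$, the superlinear norm is $|\alpha|'=\sum_{j:\,\alpha_j\ge 2}\alpha_j$ (sum over those $j$ with $\alpha_j\ge2$; it is $0$ if there are none). Define $S_r=\{\alpha\in\mathbb{N}_0^n: |\alpha|'\le r\}$ (every $\alpha\in S_r$ satisfies $0\le\alpha_j\le r$ for all $j$). The serendipity space $\mathcal{S}_r=\mathcal{S}_r(I^n)$, $I=[-1,1]$, is the real linear span of the monomials $x^\alpha=x_1^{\alpha_1}\cdots x_n^{\alpha_n}$ with $\alpha\in S_r$. For $\beta\in\{0,1,2\}^n$, the face $f_\beta$ of $[-1,1]^n$ is $f_\beta=I_{1,\beta_1}\times\cdots\times I_{n,\beta_n}$, where $I_{j,0}=\{-1\}$, $I_{j,1}=\{1\}$, $I_{j,2}=(-1,1)$ (open interval), and $S_{r,\beta}=\{\alpha\in S_r:\min(\alpha_j,2)=\beta_j \text{ for } j=1,\ldots,n\}$. $\delta_{\alpha,\alpha'}$ is $1$ if $\alpha=\alpha'$ and $0$ otherwise. *)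

theory Defs
  imports "HOL-Analysis.Analysis" "HOL-Library.Function_Algebras"
begin

definition superlinear_norm :: "nat ^ 'n \<Rightarrow> nat" where
  "superlinear_norm \<alpha> = (\<Sum>j | \<alpha> $ j \<ge> 2. \<alpha> $ j)"

definition serendipity_indices :: "nat \<Rightarrow> (nat ^ 'n) set" where
  "serendipity_indices r = {\<alpha>. superlinear_norm \<alpha> \<le> r}"

definition monomial :: "nat ^ 'n \<Rightarrow> real ^ 'n \<Rightarrow> real" where
  "monomial \<alpha> y = (\<Prod>j\<in>UNIV. (y $ j) ^ (\<alpha> $ j))"

text \<open>
  Real-valued functions are not an instance of \<open>real_vector\<close>, so linear algebra on them goes
  through an interpretation of the \<open>vector_space\<close> locale for the pointwise operations.
\<close>

definition fun_scale :: "real \<Rightarrow> ('a \<Rightarrow> real) \<Rightarrow> 'a \<Rightarrow> real" where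
  "fun_scale c f = (\<lambda>y. c * f y)"

global_interpretation fun_space: vector_space "fun_scale :: real \<Rightarrow> ('a \<Rightarrow> real) \<Rightarrow> 'a \<Rightarrow> real"
  by unfold_locales (auto simp: fun_scale_def algebra_simps)

text \<open>
  Polynomials are identified with the polynomial functions on the whole of \<open>real ^ 'n\<close>; restriction
  to the cube loses no information, as the cube has nonempty interior.
\<close>

definition serendipity_space :: "nat \<Rightarrow> (real ^ 'n \<Rightarrow> real) set" where
  "serendipity_space r = fun_space.span (monomial ` serendipity_indices r)"

definition face_factor :: "nat \<Rightarrow> real set" where
  "face_factor b = (if b = 0 then {-1} else if b = 1 then {1} else {-1<..<1})"

definition face :: "nat ^ 'n \<Rightarrow> (real ^ 'n) set" where
  "face \<beta> = {y. \<forall>j. y $ j \<in> face_factor (\<beta> $ j)}"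

definition face_indices :: "nat \<Rightarrow> nat ^ 'n \<Rightarrow> (nat ^ 'n) set" where
  "face_indices r \<beta> = {\<alpha> \<in> serendipity_indices r. \<forall>j. min (\<alpha> $ j) 2 = \<beta> $ j}"

definition node :: "('n \<Rightarrow> nat \<Rightarrow> real) \<Rightarrow> nat ^ 'n \<Rightarrow> real ^ 'n" where
  "node x \<alpha> = (\<chi> j. x j (\<alpha> $ j))"

text \<open>
  A basis indexed by a family: injectivity on the index set is needed because \<open>independent\<close>
  only sees the set of members.
\<close>

definition family_basis_of :: "('i \<Rightarrow> 'a \<Rightarrow> real) \<Rightarrow> 'i set \<Rightarrow> ('a \<Rightarrow> real) set \<Rightarrow> bool" where
  "family_basis_of \<phi> A V \<longleftrightarrow>
     inj_on \<phi> A \<and> fun_space.independent (\<phi> ` A) \<and> fun_space.span (\<phi> ` A) = V"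

end

theory Submission imports Defs begin

text \<open>
  The index set is closed downwards in the componentwise order. Hence the tensor-product Newton
  polynomials \<open>y \<mapsto> \<Prod>\<^sub>j \<Prod>\<^sub>i\<^sub><\<^sub>\<alpha>\<^sub>j (y\<^sub>j - x\<^sub>j\<^sub>i)\<close> with index \<open>\<alpha>\<close> in the set lie in the space, and since the
  one with index \<open>\<alpha>\<close> vanishes at all nodes whose index is not above \<open>\<alpha>\<close> but not at its own node,
  they give interpolants by a triangular solve. Lagrange families are then linearly independent
  and have as many members as the space has spanning monomials, so they are bases, which yields
  uniqueness.
\<close>

section \<open>Lagrange families in finitely spanned function spaces\<close>

lemma sum_fun_scale_apply:
  "(\<Sum>i\<in>A. fun_scale (c i) (f i)) y = (\<Sum>i\<in>A. c i * f i y)"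
  by (induction A rule: infinite_finite_induct) (auto simp: fun_scale_def)

lemma lagrange_sum:
  fixes c :: "'i \<Rightarrow> real"
  assumes "finite A" "\<beta> \<in> A"
    and "\<And>\<alpha>. \<alpha> \<in> A \<Longrightarrow> \<phi> \<alpha> (z \<beta>) = (if \<alpha> = \<beta> then 1 else 0)"
  shows "(\<Sum>\<alpha>\<in>A. c \<alpha> * \<phi> \<alpha> (z \<beta>)) = c \<beta>"
proof -
  have "(\<Sum>\<alpha>\<in>A. c \<alpha> * \<phi> \<alpha> (z \<beta>)) = (\<Sum>\<alpha>\<in>A. if \<alpha> = \<beta> then c \<alpha> else 0)"
    by (rule sum.cong) (auto simp: assms(3))
  then show ?thesis
    using assms(1,2) by simp
qed

text \<open>Evaluating a linear relation at \<open>z \<beta>\<close> isolates the coefficient of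
  \<open>\<phi> \<beta>\<close>, which gives independence. Spanning is then a dimension count: there
  are \<open>card A\<close> independent members and at most \<open>card A\<close> spanning
  functions.\<close>

lemma lagrange_family_basis:
  fixes \<phi> :: "'i \<Rightarrow> 'a \<Rightarrow> real" and z :: "'i \<Rightarrow> 'a"
  assumes fin: "finite A"
    and mem: "\<And>\<alpha>. \<alpha> \<in> A \<Longrightarrow> \<phi> \<alpha> \<in> fun_space.span (m ` A)"
    and delta: "\<And>\<alpha> \<beta>. \<alpha> \<in> A \<Longrightarrow> \<beta> \<in> A \<Longrightarrow> \<phi> \<alpha> (z \<beta>) = (if \<alpha> = \<beta> then 1 else 0)"
  shows "family_basis_of \<phi> A (fun_space.span (m ` A))"
proof -
  have inj: "inj_on \<phi> A"
    by (rule inj_onI) (metis delta zero_neq_one)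
  have indep: "fun_space.independent (\<phi> ` A)"
  proof (rule fun_space.independent_if_scalars_zero)
    fix f g
    assume 0: "(\<Sum>h\<in>\<phi> ` A. fun_scale (f h) h) = 0" and "g \<in> \<phi> ` A"
    then obtain \<beta> where \<beta>: "\<beta> \<in> A" "g = \<phi> \<beta>" by blast
    have "(\<Sum>\<alpha>\<in>A. fun_scale (f (\<phi> \<alpha>)) (\<phi> \<alpha>)) (z \<beta>) = 0"
      using 0 inj by (simp add: sum.reindex)
    then show "f g = 0"
      using lagrange_sum[OF fin \<beta>(1), of \<phi> z "\<lambda>\<alpha>. f (\<phi> \<alpha>)"] delta \<beta>
      by (simp add: sum_fun_scale_apply)
  qed (use fin in simp)
  have sub: "\<phi> ` A \<subseteq> fun_space.span (m ` A)"
    using mem by blast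
  have "m ` A \<subseteq> fun_space.span (\<phi> ` A)"
  proof
    fix v assume v: "v \<in> m ` A"
    show "v \<in> fun_space.span (\<phi> ` A)"
    \<comment> \<open>Adjoining \<open>v\<close> would give \<open>card A + 1\<close> independent
      functions in a space spanned by at most \<open>card A\<close>.\<close>
    proof (rule ccontr)
      assume nv: "v \<notin> fun_space.span (\<phi> ` A)"
      then have "fun_space.independent (insert v (\<phi> ` A))"
        using indep by (rule fun_space.independent_insertI)
      then have "card (insert v (\<phi> ` A)) \<le> card (m ` A)"
        using fun_space.independent_span_bound[of "m ` A" "insert v (\<phi> ` A)"] fin sub v
        by (simp add: fun_space.span_base)
      moreover have "v \<notin> \<phi> ` A"
        using nv fun_space.span_base[of v "\<phi> ` A"] by argo
      ultimately show False
        using fin card_image[OF inj] card_image_le[OF fin, of m] by simp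
    qed
  qed
  then have "fun_space.span (\<phi> ` A) = fun_space.span (m ` A)"
    using sub by (intro subset_antisym fun_space.span_minimal fun_space.subspace_span)
  with inj indep show ?thesis
    by (simp add: family_basis_of_def)
qed

text \<open>Every function in the span is its own Lagrange interpolant, hence determined by its
  values at the nodes.\<close>

lemma lagrange_span_eqI:
  assumes fin: "finite A"
    and delta: "\<And>\<alpha> \<beta>. \<alpha> \<in> A \<Longrightarrow> \<beta> \<in> A \<Longrightarrow> \<phi> \<alpha> (z \<beta>) = (if \<alpha> = \<beta> then 1 else 0)"
    and "p \<in> fun_space.span (\<phi> ` A)" "q \<in> fun_space.span (\<phi> ` A)"
    and eq: "\<And>\<alpha>. \<alpha> \<in> A \<Longrightarrow> p (z \<alpha>) = q (z \<alpha>)"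
  shows "p = q"
proof -
  have inj: "inj_on \<phi> A"
    by (rule inj_onI) (metis delta zero_neq_one)
  have expand: "g = (\<lambda>y. \<Sum>\<alpha>\<in>A. g (z \<alpha>) * \<phi> \<alpha> y)" if g: "g \<in> fun_space.span (\<phi> ` A)" for g
  proof -
    obtain c where "g = (\<Sum>h\<in>\<phi> ` A. fun_scale (c h) h)"
      using g fin by (auto simp: fun_space.span_finite)
    then have c: "g y = (\<Sum>\<alpha>\<in>A. c (\<phi> \<alpha>) * \<phi> \<alpha> y)" for y
      using inj by (simp add: sum.reindex sum_fun_scale_apply)
    have "g (z \<beta>) = c (\<phi> \<beta>)" if "\<beta> \<in> A" for \<beta>
      unfolding c using lagrange_sum[OF fin that, of \<phi> z "\<lambda>\<alpha>. c (\<phi> \<alpha>)"] delta that by simp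
    with c show ?thesis by (auto intro!: sum.cong)
  qed
  have "(\<lambda>y. \<Sum>\<alpha>\<in>A. p (z \<alpha>) * \<phi> \<alpha> y) = (\<lambda>y. \<Sum>\<alpha>\<in>A. q (z \<alpha>) * \<phi> \<alpha> y)"
    using eq by (auto intro!: sum.cong)
  then show ?thesis
    using expand[OF assms(3)] expand[OF assms(4)] by simp
qed

section \<open>The serendipity index set\<close>

text \<open>Lowering a component shrinks its summand in the superlinear norm, or removes it once the
  component drops below 2.\<close>

lemma serendipity_indices_mono:
  assumes "\<alpha> \<in> serendipity_indices r" "\<And>j. \<beta> $ j \<le> \<alpha> $ j"
  shows "\<beta> \<in> serendipity_indices r"
proof -
  have "superlinear_norm \<beta> \<le> (\<Sum>j | \<beta> $ j \<ge> 2. \<alpha> $ j)"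
    unfolding superlinear_norm_def by (intro sum_mono assms(2))
  also have "\<dots> \<le> superlinear_norm \<alpha>"
    unfolding superlinear_norm_def
    by (intro sum_mono2) (auto intro: order_trans[OF _ assms(2)])
  finally show ?thesis
    using assms(1) by (simp add: serendipity_indices_def)
qed

text \<open>The norm bounds only components that are at least 2; for components 0 and 1 the bound
  comes from \<open>r \<ge> 1\<close>.\<close>

lemma serendipity_indices_le:
  assumes "\<alpha> \<in> serendipity_indices r" "r \<ge> 1"
  shows "\<alpha> $ j \<le> r"
proof (cases "\<alpha> $ j \<ge> 2")
  case True
  then have "\<alpha> $ j \<le> superlinear_norm \<alpha>"
    unfolding superlinear_norm_def by (intro member_le_sum) auto
  then show ?thesis
    using assms(1) by (simp add: serendipity_indices_def)
qed (use assms(2) in simp)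

lemma finite_serendipity_indices:
  assumes "r \<ge> 1"
  shows "finite (serendipity_indices r :: (nat ^ 'n::finite) set)"
proof (rule finite_subset)
  show "serendipity_indices r \<subseteq> vec_lambda ` (PiE (UNIV :: 'n set) (\<lambda>_. {..r}))"
  proof
    fix \<alpha> :: "nat ^ 'n"
    assume "\<alpha> \<in> serendipity_indices r"
    then have "vec_nth \<alpha> \<in> PiE UNIV (\<lambda>_. {..r})"
      using serendipity_indices_le assms by auto
    then show "\<alpha> \<in> vec_lambda ` (PiE (UNIV :: 'n set) (\<lambda>_. {..r}))"
      by (metis image_eqI vec_nth_inverse)
  qed
qed (auto intro!: finite_imageI finite_PiE)

section \<open>Tensor-product Newton polynomials and interpolation\<close>

definition newton_poly :: "('n \<Rightarrow> nat \<Rightarrow> real) \<Rightarrow> nat ^ 'n \<Rightarrow> real ^ 'n \<Rightarrow> real" where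
  "newton_poly x \<alpha> y = (\<Prod>j\<in>UNIV. \<Prod>i<\<alpha> $ j. y $ j - x j i)"

text \<open>In coordinate \<open>j\<close> the factor with \<open>i = \<beta> $ j\<close> occurs in
  the product and vanishes at the node.\<close>

lemma newton_poly_node_eq_0:
  fixes \<alpha> \<beta> :: "nat ^ 'n::finite"
  assumes "\<beta> $ j < \<alpha> $ j"
  shows "newton_poly x \<alpha> (node x \<beta>) = 0"
  unfolding newton_poly_def node_def using assms
  by (auto intro!: prod_zero bexI[of _ j] bexI[of _ "\<beta> $ j"])

lemma newton_poly_node_neq_0:
  fixes \<alpha> :: "nat ^ 'n::finite"
  assumes "\<And>j. inj_on (x j) {..\<alpha> $ j}"
  shows "newton_poly x \<alpha> (node x \<alpha>) \<noteq> 0"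
proof -
  have "x j (\<alpha> $ j) \<noteq> x j i" if "i < \<alpha> $ j" for i j
    using inj_onD[OF assms[of j], of "\<alpha> $ j" i] that by auto
  then show ?thesis
    by (simp add: newton_poly_def node_def)
qed

text \<open>One coefficient sequence serves all \<open>t\<close>, and the exponents stop at
  \<open>k\<close>; both are needed to multiply out the tensor product below
  \<open>\<alpha>\<close>.\<close>

lemma newton_factor_expand:
  fixes a :: "nat \<Rightarrow> real"
  shows "\<exists>c. \<forall>t. (\<Prod>i<k. t - a i) = (\<Sum>l\<le>k. c l * t ^ l)"
proof -
  define q where "q = (\<Prod>i<k. [:- a i, 1:])"
  have "degree q \<le> (\<Sum>i<k. degree [:- a i, 1:])"
    unfolding q_def by (rule order_trans[OF degree_prod_sum_le]) auto
  then have "degree q \<le> k" by simp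
  then have "poly q t = (\<Sum>l\<le>k. coeff q l * t ^ l)" for t
    unfolding poly_altdef by (intro sum.mono_neutral_left) (auto simp: coeff_eq_0)
  then show ?thesis
    by (auto simp: q_def poly_prod intro!: exI[of _ "coeff q"])
qed

lemma newton_poly_in_serendipity_space:
  fixes \<alpha> :: "nat ^ 'n::finite"
  assumes "\<alpha> \<in> serendipity_indices r"
  shows "newton_poly x \<alpha> \<in> serendipity_space r"
proof -
  have "\<forall>j. \<exists>c. \<forall>t. (\<Prod>i<\<alpha> $ j. t - x j i) = (\<Sum>l\<le>\<alpha> $ j. c l * t ^ l)"
    using newton_factor_expand by blast
  then obtain c where c: "\<And>j t. (\<Prod>i<\<alpha> $ j. t - x j i) = (\<Sum>l\<le>\<alpha> $ j. c j l * t ^ l)"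
    by metis
  \<comment> \<open>Distributing the product over the sums, each \<open>g\<close> picks one exponent
    per coordinate. All these exponents lie below \<open>\<alpha>\<close>, so downward closure
    applies.\<close>
  let ?P = "PiE (UNIV :: 'n set) (\<lambda>j. {..\<alpha> $ j})"
  have "newton_poly x \<alpha> y = (\<Sum>g\<in>?P. (\<Prod>j\<in>UNIV. c j (g j)) * monomial (vec_lambda g) y)" for y
    by (simp add: newton_poly_def monomial_def c prod_sum_PiE prod.distrib)
  then have "newton_poly x \<alpha> =
      (\<Sum>g\<in>?P. fun_scale (\<Prod>j\<in>UNIV. c j (g j)) (monomial (vec_lambda g)))"
    by (auto simp: sum_fun_scale_apply)
  moreover have "vec_lambda g \<in> serendipity_indices r" if "g \<in> ?P" for g
    using that by (intro serendipity_indices_mono[OF assms]) auto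
  ultimately show ?thesis
    unfolding serendipity_space_def
    by (simp add: fun_space.span_sum fun_space.span_scale fun_space.span_base)
qed

lemma newton_interpolation:
  fixes A :: "(nat ^ 'n::finite) set"
  assumes "finite A" and "A \<subseteq> serendipity_indices r"
    and "\<And>\<alpha> j. \<alpha> \<in> A \<Longrightarrow> inj_on (x j) {..\<alpha> $ j}"
  shows "\<exists>p \<in> serendipity_space r. \<forall>\<alpha>\<in>A. p (node x \<alpha>) = u \<alpha>"
  using assms
\<comment> \<open>Indices are added in order of nondecreasing component sum, so the new index is
  never strictly below an old one componentwise. The rule does not promise that the inserted index
  is new, hence the case split.\<close>
proof (induction A rule: finite_ranking_induct[where f = "\<lambda>\<alpha>. \<Sum>j\<in>UNIV. \<alpha> $ j"])
  case empty
  then show ?case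
    by (auto simp: serendipity_space_def intro: fun_space.span_zero)
next
  case (insert \<alpha> A)
  show ?case
  proof (cases "\<alpha> \<in> A")
    case True
    then show ?thesis
      using insert.IH insert.prems by (simp add: insert_absorb)
  next
    case False
    obtain p where p: "p \<in> serendipity_space r" "\<forall>\<beta>\<in>A. p (node x \<beta>) = u \<beta>"
      using insert.IH insert.prems by auto
    \<comment> \<open>The multiple of the Newton polynomial that corrects the value at the new node;
      the values at the old nodes are left unchanged.\<close>
    define c where "c = (u \<alpha> - p (node x \<alpha>)) / newton_poly x \<alpha> (node x \<alpha>)"
    let ?q = "p + fun_scale c (newton_poly x \<alpha>)"
    have "?q \<in> serendipity_space r"
      using p(1) newton_poly_in_serendipity_space[of \<alpha> r x] insert.prems
      unfolding serendipity_space_def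
      by (auto intro!: fun_space.span_add fun_space.span_scale)
    moreover have "?q (node x \<alpha>) = u \<alpha>"
      using newton_poly_node_neq_0[of x \<alpha>] insert.prems by (simp add: fun_scale_def c_def)
    moreover have "?q (node x \<beta>) = u \<beta>" if "\<beta> \<in> A" for \<beta>
    proof -
      \<comment> \<open>Otherwise \<open>\<beta>\<close> would dominate \<open>\<alpha>\<close> and
        differ from it, so its component sum would be larger, against the insertion order.\<close>
      have "\<exists>j. \<beta> $ j < \<alpha> $ j"
      proof (rule ccontr)
        assume "\<nexists>j. \<beta> $ j < \<alpha> $ j"
        then have le: "\<alpha> $ j \<le> \<beta> $ j" for j
          by (simp add: not_less)
        have "\<alpha> \<noteq> \<beta>" using that False by auto
        then obtain i where "\<alpha> $ i \<noteq> \<beta> $ i"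
          by (auto simp: vec_eq_iff)
        then have "\<alpha> $ i < \<beta> $ i" using le[of i] by simp
        then have "(\<Sum>j\<in>UNIV. \<alpha> $ j) < (\<Sum>j\<in>UNIV. \<beta> $ j)"
          using le by (intro sum_strict_mono_ex1) auto
        then show False using insert.hyps(2)[OF that] by simp
      qed
      then show ?thesis
        using newton_poly_node_eq_0[of \<beta> _ \<alpha> x] p(2) that by (auto simp: fun_scale_def)
    qed
    ultimately show ?thesis by blast
  qed
qed

section \<open>Nodes on faces, unisolvence and Lagrange bases\<close>

theorem mainTheorem1:
  fixes r :: nat and x :: "'n::finite \<Rightarrow> nat \<Rightarrow> real"
  assumes "r \<ge> 1"
    and "\<And>j. x j 0 = -1"
    and "\<And>j. x j 1 = 1"
    and "\<And>j k. 2 \<le> k \<Longrightarrow> k \<le> r \<Longrightarrow> x j k \<in> {-1<..<1}"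
  shows "(\<forall>\<beta> :: nat ^ 'n. (\<forall>j. \<beta> $ j \<in> {0, 1, 2}) \<longrightarrow>
            (\<forall>\<alpha> \<in> serendipity_indices r. node x \<alpha> \<in> face \<beta> \<longleftrightarrow> \<alpha> \<in> face_indices r \<beta>))
       \<and> ((\<forall>j. inj_on (x j) {2..r}) \<longrightarrow>
            (\<forall>u :: real ^ 'n \<Rightarrow> real. \<exists>!p. p \<in> serendipity_space r \<and>
               (\<forall>\<alpha> \<in> serendipity_indices r. p (node x \<alpha>) = u (node x \<alpha>)))
          \<and> (\<forall>\<alpha> \<in> serendipity_indices r. \<exists>!p. p \<in> serendipity_space r \<and>
               (\<forall>\<alpha>' \<in> serendipity_indices r. p (node x \<alpha>') = (if \<alpha> = \<alpha>' then 1 else 0)))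
          \<and> (\<forall>\<phi> :: nat ^ 'n \<Rightarrow> real ^ 'n \<Rightarrow> real.
               (\<forall>\<alpha> \<in> serendipity_indices r. \<phi> \<alpha> \<in> serendipity_space r \<and>
                  (\<forall>\<alpha>' \<in> serendipity_indices r. \<phi> \<alpha> (node x \<alpha>') = (if \<alpha> = \<alpha>' then 1 else 0)))
               \<longrightarrow> family_basis_of \<phi> (serendipity_indices r) (serendipity_space r)))"
proof -
  let ?S = "serendipity_indices r :: (nat ^ 'n) set"
  let ?V = "serendipity_space r :: (real ^ 'n \<Rightarrow> real) set"
  \<comment> \<open>The three face factors are pairwise disjoint, so the factor containing a
    coordinate reveals \<open>min k 2\<close>. This gives the claim about faces and also separates
    the endpoints from the interior points.\<close>
  have factor: "x j k \<in> face_factor b \<longleftrightarrow> min k 2 = b" if "k \<le> r" "b \<in> {0, 1, 2}" for j k b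
  proof -
    consider "k = 0" | "k = 1" | "k \<ge> 2" by linarith
    then show ?thesis
      using that assms(2,3)[of j] assms(4)[of k j]
      by cases (auto simp: face_factor_def)
  qed
  have "node x \<alpha> \<in> face \<beta> \<longleftrightarrow> \<alpha> \<in> face_indices r \<beta>"
    if "\<forall>j. \<beta> $ j \<in> {0, 1, 2}" "\<alpha> \<in> ?S" for \<alpha> \<beta> :: "nat ^ 'n"
    using factor[OF serendipity_indices_le[OF that(2) assms(1)]] that
    by (simp add: face_def face_indices_def node_def)
  moreover
  {
    assume inj2: "\<forall>j. inj_on (x j) {2..r}"
    have inj: "inj_on (x j) {..r}" for j
    proof (rule inj_onI)
      fix k l assume kl: "k \<in> {..r}" "l \<in> {..r}" and eq: "x j k = x j l"
      have b: "min l 2 \<in> {0, 1, 2}"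
        by (simp add: min_def) linarith
      \<comment> \<open>Equal coordinates lie in the same face factor. Thus either both indices are
        the same endpoint index, or both are at least 2 and the assumed injectivity applies.\<close>
      have "min k 2 = min l 2"
        using factor[OF _ b, of k j] factor[OF _ b, of l j] kl eq by (metis atMost_iff)
      then have "k = l \<or> k \<in> {2..r} \<and> l \<in> {2..r}"
        using kl by (cases "k \<le> 2"; cases "l \<le> 2") (simp_all add: min_def)
      then show "k = l"
        using inj_onD[OF spec[OF inj2] eq] by blast
    qed
    have fin: "finite ?S"
      using assms(1) by (rule finite_serendipity_indices)
    have injS: "inj_on (x j) {..\<alpha> $ j}" if "\<alpha> \<in> ?S" for \<alpha> j
      using serendipity_indices_le[OF that assms(1), of j] by (intro inj_on_subset[OF inj]) auto
    \<comment> \<open>The data are indexed by \<open>\<alpha>\<close> rather than by points, so that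
      nodal values of a function and Kronecker deltas are both instances.\<close>
    have ex: "\<exists>p \<in> ?V. \<forall>\<alpha>\<in>?S. p (node x \<alpha>) = u \<alpha>" for u :: "nat ^ 'n \<Rightarrow> real"
      by (rule newton_interpolation[OF fin order_refl injS])
    \<comment> \<open>For \<open>\<alpha>\<close> outside the index set the prescribed data are zero
      on \<open>?S\<close>, so a family can be chosen for all \<open>\<alpha>\<close> at
      once.\<close>
    have "\<forall>\<alpha>. \<exists>p \<in> ?V. \<forall>\<beta>\<in>?S. p (node x \<beta>) = (if \<alpha> = \<beta> then 1 else 0)"
      by (rule allI, rule ex)
    then obtain \<phi> where \<phi>: "\<And>\<alpha>. \<phi> \<alpha> \<in> ?V"
        "\<And>\<alpha> \<beta>. \<beta> \<in> ?S \<Longrightarrow> \<phi> \<alpha> (node x \<beta>) = (if \<alpha> = \<beta> then 1 else 0)"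
      by metis
    have basis: "family_basis_of \<psi> ?S ?V"
      if "\<forall>\<alpha> \<in> ?S. \<psi> \<alpha> \<in> ?V \<and> (\<forall>\<beta> \<in> ?S. \<psi> \<alpha> (node x \<beta>) = (if \<alpha> = \<beta> then 1 else 0))" for \<psi>
      using that lagrange_family_basis[OF fin, of \<psi> monomial "node x"]
      unfolding serendipity_space_def by blast
    \<comment> \<open>The basis property of this one constructed family makes every member of
      \<open>?V\<close> a Lagrange expansion, whence uniqueness.\<close>
    have "fun_space.span (\<phi> ` ?S) = ?V"
      using basis[of \<phi>] \<phi> by (simp add: family_basis_of_def)
    then have uniq: "p = q" if "p \<in> ?V" "q \<in> ?V" "\<forall>\<alpha>\<in>?S. p (node x \<alpha>) = q (node x \<alpha>)" for p q
      using lagrange_span_eqI[OF fin, of \<phi> "node x" p q] \<phi> that by simp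
    have ex1: "\<exists>!p. p \<in> ?V \<and> (\<forall>\<alpha>\<in>?S. p (node x \<alpha>) = u \<alpha>)" for u :: "nat ^ 'n \<Rightarrow> real"
    proof (rule ex_ex1I)
      show "\<exists>p. p \<in> ?V \<and> (\<forall>\<alpha>\<in>?S. p (node x \<alpha>) = u \<alpha>)"
        using ex[of u] by blast
      show "p = q" if "p \<in> ?V \<and> (\<forall>\<alpha>\<in>?S. p (node x \<alpha>) = u \<alpha>)"
          "q \<in> ?V \<and> (\<forall>\<alpha>\<in>?S. q (node x \<alpha>) = u \<alpha>)" for p q
        using that by (intro uniq) simp_all
    qed
    note basis ex1
  }
  ultimately show ?thesis
    by (intro conjI allI impI ballI) simp_all
qed

end
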